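(* Let $\kappa<0$, $0<\alpha<1$, $T>0$, let $N\ge 2$ be an integer, $\tau=T/N$ and $t_n=n\tau$. Let $u$ be the solution of $u'(t)=\kappa u(t)+f(t)$, $0<t\le T$, $u(0)=u_0$, and suppose that $u$ satisfies the regularity bound $|u^{(k)}(t)|\le M\,t^{\alpha-k}$ for $k=1,2,3$ and $0<t\le T$, with some constant $M$. Let $U^n$ be given by the implicit Euler scheme $$\frac{U^n-U^{n-1}}{\tau}=\kappa U^n+f(t_n),\quad 1\le n\le N,\qquad U^0=u_0,$$ and let $e^n=u(t_n)-U^n$. Then there is a constant $C_{u,\alpha}>0$ depending only on $\alpha$ and $M$ such that, whenever $-\kappa\tau<1$, for all $2\le n\le N$, $$|e^n|\le e^{\kappa t_n/2}|e^{0}|+C_{u,\alpha}\Big(C_1e^{\kappa t_n/4}\tau^\alpha+C_2\,t_{n-1}^{\alpha-1}\tau\Big),$$ where $C_1:=\frac{2}{1-\alpha}+3e^{\kappa t_n/4}$ and $$C_2:=\begin{cases}\frac{1}{1-\alpha}\big(2^{1-\alpha}(1-e^{\kappa t_n/4})-1\big), & t_n>\frac{4}{\kappa}\ln(1-2^{\alpha-1}),\\ 0,& t_n\le \frac{4}{\kappa}\ln(1-2^{\alpha-1}).\end{cases}$$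
   Context: The solution $u$ is real-valued, continuous on $[0,T]$ and three times continuously differentiable on $(0,T]$, with a possible weak singularity at $t=0$; $f$ is the corresponding given source term on $(0,T]$. The constant $C_{u,\alpha}$ is independent of $n$, $N$, $\tau$, $T$ and $\kappa$. *)

theory Defs
  imports "HOL-Analysis.Analysis"
begin

(* Derivatives are taken relative to S, so on S = {0<..T} the derivative at T is the
   one-sided one and no values of u outside (0,T] are involved. *)
primrec deriv_within :: "real set \<Rightarrow> nat \<Rightarrow> (real \<Rightarrow> real) \<Rightarrow> real \<Rightarrow> real" where
  "deriv_within S 0 u = u"
| "deriv_within S (Suc k) u = (\<lambda>t. vector_derivative (deriv_within S k u) (at t within S))"

definition C_k_on :: "nat \<Rightarrow> (real \<Rightarrow> real) \<Rightarrow> real set \<Rightarrow> bool" where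
  "C_k_on k u S \<longleftrightarrow>
     (\<forall>j<k. deriv_within S j u differentiable_on S) \<and>
     (\<forall>j\<le>k. continuous_on S (deriv_within S j u))"

definition solves_ivp ::
  "real \<Rightarrow> (real \<Rightarrow> real) \<Rightarrow> real \<Rightarrow> real \<Rightarrow> (real \<Rightarrow> real) \<Rightarrow> bool" where
  "solves_ivp \<kappa> f u0 T u \<longleftrightarrow>
     continuous_on {0..T} u \<and> C_k_on 3 u {0<..T} \<and>
     (\<forall>t\<in>{0<..T}. deriv_within {0<..T} 1 u t = \<kappa> * u t + f t) \<and> u 0 = u0"

definition regularity_bound :: "real \<Rightarrow> real \<Rightarrow> real \<Rightarrow> (real \<Rightarrow> real) \<Rightarrow> bool" where
  "regularity_bound \<alpha> M T u \<longleftrightarrow>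
     (\<forall>k\<in>{1..3}. \<forall>t\<in>{0<..T}. \<bar>deriv_within {0<..T} k u t\<bar> \<le> M * t powr (\<alpha> - real k))"

definition implicit_euler ::
  "real \<Rightarrow> (real \<Rightarrow> real) \<Rightarrow> real \<Rightarrow> real \<Rightarrow> nat \<Rightarrow> (nat \<Rightarrow> real) \<Rightarrow> bool" where
  "implicit_euler \<kappa> f u0 \<tau> N U \<longleftrightarrow>
     U 0 = u0 \<and>
     (\<forall>n\<in>{1..N}. (U n - U (n - 1)) / \<tau> = \<kappa> * U n + f (real n * \<tau>))"

definition C1 :: "real \<Rightarrow> real \<Rightarrow> real \<Rightarrow> real" where
  "C1 \<alpha> \<kappa> t = 2 / (1 - \<alpha>) + 3 * exp (\<kappa> * t / 4)"

definition C2 :: "real \<Rightarrow> real \<Rightarrow> real \<Rightarrow> real" where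
  "C2 \<alpha> \<kappa> t =
     (if t > 4 / \<kappa> * ln (1 - 2 powr (\<alpha> - 1))
      then 1 / (1 - \<alpha>) * (2 powr (1 - \<alpha>) * (1 - exp (\<kappa> * t / 4)) - 1)
      else 0)"

end

theory Submission imports Defs
begin

text \<open>
  The error satisfies \<open>(1 - \<kappa>\<tau>) e\<^sub>n = e\<^sub>n\<^sub>-\<^sub>1 + \<tau> r\<^sub>n\<close>, where the regularity bound gives
  \<open>\<bar>\<tau> r\<^sub>n\<bar> \<le> B \<tau>\<^sup>\<alpha> n powr (\<alpha> - 2)\<close>, including the singular first step. As \<open>-\<kappa>\<tau> < 1\<close>, each
  division by \<open>1 - \<kappa>\<tau>\<close> damps by at least \<open>exp (\<kappa>\<tau>/2)\<close>. In the resulting convolution sum the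
  early steps have travelled over at least half of \<open>[0, t\<^sub>n]\<close>, so they carry the factor
  \<open>exp (\<kappa> t\<^sub>n/4)\<close> and a convergent series remains; the late steps contribute
  \<open>O(\<tau>\<^sup>\<alpha> n powr (\<alpha> - 1))\<close>. When \<open>exp (\<kappa> t\<^sub>n/4)\<close> is bounded away from zero this last part is
  absorbed by the \<open>C1\<close> term, and otherwise \<open>C2\<close> is bounded away from zero.
\<close>

section \<open>Truncation error of one implicit Euler step\<close>

lemma C_k_on_has_derivative:
  assumes "C_k_on k u {0<..T}" "j < k" "0 < t" "t < T"
  shows "(deriv_within {0<..T} j u has_real_derivative deriv_within {0<..T} (Suc j) u t) (at t)"
proof -
  let ?g = "deriv_within {0<..T} j u"
  have "?g differentiable (at t within {0<..T})"
    using assms by (auto simp: C_k_on_def differentiable_on_def)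
  then have "(?g has_vector_derivative vector_derivative ?g (at t within {0<..T}))
      (at t within {0<..T})"
    by (simp add: vector_derivative_works)
  \<comment> \<open>Strictly inside the interval the derivative relative to \<open>{0<..T}\<close>
    is two-sided; only \<open>T\<close> itself is exceptional.\<close>
  moreover have "at t within {0<..T} = at t"
    using assms by (intro at_within_open_subset[of t "{0<..<T}"]) auto
  ultimately show ?thesis
    by (simp add: has_real_derivative_iff_has_vector_derivative)
qed

lemma C_k_on_continuous:
  assumes "C_k_on k u {0<..T}" "j \<le> k" "0 < a" "b \<le> T"
  shows "continuous_on {a..b} (deriv_within {0<..T} j u)"
  using assms by (auto simp: C_k_on_def intro: continuous_on_subset)

text \<open>The bound on \<open>g'\<close> may blow up at 0 but has the antiderivative
  \<open>M / \<alpha> * t powr \<alpha>\<close>, which is continuous there. Subtracting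
  \<open>g\<close> or \<open>-g\<close> from it gives an increasing function, by a monotonicity
  criterion that differentiates only in the open interval.\<close>

lemma increment_le_powr:
  fixes g g' :: "real \<Rightarrow> real"
  assumes "0 < \<alpha>" "0 \<le> s" "continuous_on {0..s} g"
    and der: "\<And>t. 0 < t \<Longrightarrow> t < s \<Longrightarrow> (g has_real_derivative g' t) (at t)"
    and bd: "\<And>t. 0 < t \<Longrightarrow> t < s \<Longrightarrow> \<bar>g' t\<bar> \<le> M * t powr (\<alpha> - 1)"
  shows "\<bar>g s - g 0\<bar> \<le> M / \<alpha> * s powr \<alpha>"
proof -
  have *: "c * (g s - g 0) \<le> M / \<alpha> * s powr \<alpha>" if c: "\<bar>c\<bar> = 1" for c :: real
  proof -
    let ?h = "\<lambda>t. M / \<alpha> * t powr \<alpha> - c * g t"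
    have "?h 0 \<le> ?h s"
    proof (rule DERIV_nonneg_imp_increasing_open[where f = ?h and a = 0 and b = s])
      show "continuous_on {0..s} ?h"
        using assms by (auto intro!: continuous_intros continuous_on_powr')
      fix t assume t: "0 < t" "t < s"
      have "(?h has_real_derivative M / \<alpha> * (\<alpha> * t powr (\<alpha> - 1)) - c * g' t) (at t)"
        using t by (intro DERIV_diff DERIV_cmult has_real_derivative_powr der)
      moreover have "c * g' t \<le> \<bar>g' t\<bar>"
        using c by (metis abs_ge_self abs_mult mult_1)
      ultimately show "\<exists>y. (?h has_real_derivative y) (at t) \<and> 0 \<le> y"
        using bd[OF t] \<open>0 < \<alpha>\<close> by (intro exI conjI) auto
    qed (use assms in simp)
    then show ?thesis by (simp add: right_diff_distrib)
  qed
  from *[of 1] *[of "-1"] show ?thesis by (simp add: abs_le_iff)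
qed

text \<open>The bound on the second derivative blows up at the left endpoint of this step, so no
  Taylor cancellation is sought: the increment and the derivative term are each of order
  \<open>s powr \<alpha>\<close> on their own.\<close>

lemma truncation_first_step:
  assumes "0 < \<alpha>" "solves_ivp \<kappa> f u0 T u" "regularity_bound \<alpha> M T u" "0 < s" "s \<le> T"
  shows "\<bar>u s - u 0 - s * deriv_within {0<..T} 1 u s\<bar> \<le> M * (1 + 1 / \<alpha>) * s powr \<alpha>"
proof -
  let ?u' = "deriv_within {0<..T} 1 u"
  have C3: "C_k_on 3 u {0<..T}" and cont: "continuous_on {0..T} u"
    using assms by (auto simp: solves_ivp_def)
  have bd: "\<bar>?u' t\<bar> \<le> M * t powr (\<alpha> - 1)" if "0 < t" "t \<le> T" for t
    using assms(3) that unfolding regularity_bound_def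
    by (drule_tac bspec[where x=1]) (auto)
  have "\<bar>u s - u 0\<bar> \<le> M / \<alpha> * s powr \<alpha>"
  proof (rule increment_le_powr)
    show "continuous_on {0..s} u"
      using cont assms by (auto intro: continuous_on_subset)
    show "(u has_real_derivative ?u' t) (at t)" if "0 < t" "t < s" for t
      using C_k_on_has_derivative[OF C3, of 0 t] that assms by simp
    show "\<bar>?u' t\<bar> \<le> M * t powr (\<alpha> - 1)" if "0 < t" "t < s" for t
      using bd[of t] that assms by simp
  qed (use assms in auto)
  moreover have "\<bar>s * ?u' s\<bar> \<le> M * s powr \<alpha>"
  proof -
    have "\<bar>s * ?u' s\<bar> \<le> s * (M * s powr (\<alpha> - 1))"
      using bd[of s] assms by (simp add: abs_mult)
    also have "\<dots> = M * s powr \<alpha>"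
      using assms by (simp add: powr_diff)
    finally show ?thesis .
  qed
  ultimately show ?thesis by (simp add: algebra_simps)
qed

text \<open>Away from 0 the mean value theorem is applied twice, to \<open>u\<close> on
  \<open>{a..b}\<close> and to its derivative on \<open>{y..b}\<close>. The bound on the second
  derivative decreases in t, so it is largest at \<open>a\<close>.\<close>

lemma truncation_later_step:
  assumes "\<alpha> < 1" "0 \<le> M" "C_k_on 3 u {0<..T}" "regularity_bound \<alpha> M T u"
    and "0 < a" "a < b" "b \<le> T"
  shows "\<bar>u b - u a - (b - a) * deriv_within {0<..T} 1 u b\<bar> \<le> M * a powr (\<alpha> - 2) * (b - a)\<^sup>2"
proof -
  let ?D = "\<lambda>j. deriv_within {0<..T} j u"
  have mean: "\<exists>z. x < z \<and> z < b \<and> ?D j b - ?D j x = (b - x) * ?D (Suc j) z"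
    if "a \<le> x" "x < b" "j < 3" for x j
  proof -
    have "continuous_on {x..b} (?D j)"
      using C_k_on_continuous[OF assms(3)] that assms by simp
    moreover have "(?D j has_real_derivative ?D (Suc j) z) (at z)" if "x < z" "z < b" for z
      using C_k_on_has_derivative[OF assms(3) \<open>j < 3\<close>, of z] that \<open>a \<le> x\<close> assms by simp
    ultimately obtain z where "x < z" "z < b" "?D j b - ?D j x = ?D (Suc j) z * (b - x)"
      using mvt[OF \<open>x < b\<close>, of "?D j" "\<lambda>z. (*) (?D (Suc j) z)"]
      by (auto simp: has_field_derivative_def)
    then show ?thesis by (auto simp: mult.commute)
  qed
  obtain y where y: "a < y" "y < b" "u b - u a = (b - a) * ?D 1 y"
    using mean[of a 0] assms by auto
  obtain z where z: "y < z" "z < b" "?D 1 b - ?D 1 y = (b - y) * ?D 2 z"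
    using mean[of y 1] y by (auto simp: numeral_2_eq_2)
  have "\<bar>?D 2 z\<bar> \<le> M * z powr (\<alpha> - 2)"
    using assms(4) z y assms unfolding regularity_bound_def
    by (drule_tac bspec[where x=2]) (auto)
  also have "\<dots> \<le> M * a powr (\<alpha> - 2)"
    using assms y z by (intro mult_left_mono powr_mono2') auto
  finally have D2: "\<bar>?D 2 z\<bar> \<le> M * a powr (\<alpha> - 2)" .
  have "u b - u a - (b - a) * ?D 1 b = - ((b - a) * (b - y) * ?D 2 z)"
    using y(3) z(3) by algebra
  then have "\<bar>u b - u a - (b - a) * ?D 1 b\<bar> = ((b - a) * (b - y)) * \<bar>?D 2 z\<bar>"
    using y by (simp add: abs_mult)
  also have "\<dots> \<le> ((b - a) * (b - a)) * (M * a powr (\<alpha> - 2))"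
    using D2 y by (intro mult_mono) auto
  finally show ?thesis by (simp add: power2_eq_square mult_ac)
qed

text \<open>Weighting by the index \<open>Suc j\<close> of the right endpoint, instead of
  \<open>j\<close>, lets the singular step \<open>j = 0\<close> share one formula with the
  others.\<close>

lemma truncation_bound:
  fixes j :: nat
  assumes "0 < \<alpha>" "\<alpha> < 1" "0 < \<tau>" "real (Suc j) * \<tau> \<le> T"
    and "solves_ivp \<kappa> f u0 T u" "regularity_bound \<alpha> M T u"
  shows "\<bar>u (real (Suc j) * \<tau>) - u (real j * \<tau>) - \<tau> * deriv_within {0<..T} 1 u (real (Suc j) * \<tau>)\<bar>
    \<le> 4 * \<bar>M\<bar> * (1 + 1 / \<alpha>) * \<tau> powr \<alpha> * real (Suc j) powr (\<alpha> - 2)"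
proof -
  have "0 < T"
    using assms(3,4) by (smt (verit) mult_pos_pos of_nat_0_less_iff zero_less_Suc)
  \<comment> \<open>The regularity bound at \<open>T\<close> with \<open>k = 1\<close> dominates an
    absolute value, which forces the sign of \<open>M\<close>.\<close>
  then have "0 \<le> M * T powr (\<alpha> - 1)"
    using assms(6) unfolding regularity_bound_def
    by (drule_tac bspec[where x=1]) (auto dest!: bspec[where x=T])
  then have M: "0 \<le> M"
    using \<open>0 < T\<close> by (simp add: zero_le_mult_iff)
  show ?thesis
  proof (cases j)
    case 0
    have "\<bar>u \<tau> - u 0 - \<tau> * deriv_within {0<..T} 1 u \<tau>\<bar> \<le> M * (1 + 1 / \<alpha>) * \<tau> powr \<alpha>"
      using assms 0 by (intro truncation_first_step) auto
    also have "\<dots> \<le> 4 * (M * (1 + 1 / \<alpha>) * \<tau> powr \<alpha>)"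
      using M assms by (simp add: mult_nonneg_nonneg)
    finally show ?thesis using M 0 by (simp add: mult_ac)
  next
    case (Suc i)
    let ?a = "real j * \<tau>" and ?b = "real (Suc j) * \<tau>"
    have j: "1 \<le> real j" using Suc by simp
    have ba: "?b - ?a = \<tau>" by (simp add: algebra_simps)
    have "\<bar>u ?b - u ?a - (?b - ?a) * deriv_within {0<..T} 1 u ?b\<bar>
        \<le> M * ?a powr (\<alpha> - 2) * (?b - ?a)\<^sup>2"
      using assms M j by (intro truncation_later_step) (auto simp: solves_ivp_def)
    also have "\<dots> = M * \<tau> powr \<alpha> * real j powr (\<alpha> - 2)"
      unfolding ba using assms j by (simp add: powr_mult powr_diff power2_eq_square powr_numeral)
    \<comment> \<open>For \<open>j \<ge> 1\<close>, \<open>j\<close> is at least half of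
      \<open>Suc j\<close>; the shift of index costs \<open>2 powr (2 - \<alpha>)\<close>, at most
      4.\<close>
    also have "\<dots> \<le> M * \<tau> powr \<alpha> * (4 * real (Suc j) powr (\<alpha> - 2))"
    proof -
      have "real j powr (\<alpha> - 2) \<le> (real (Suc j) / 2) powr (\<alpha> - 2)"
        using j assms by (intro powr_mono2') auto
      also have "\<dots> = 2 powr (2 - \<alpha>) * real (Suc j) powr (\<alpha> - 2)"
        using powr_minus_divide[of 2 "\<alpha> - 2"] by (simp add: powr_divide)
      also have "\<dots> \<le> 2 powr 2 * real (Suc j) powr (\<alpha> - 2)"
        using assms by (intro mult_right_mono powr_mono) auto
      finally show ?thesis using M by (intro mult_left_mono) auto
    qed
    also have "\<dots> \<le> (1 + 1 / \<alpha>) * (M * \<tau> powr \<alpha> * (4 * real (Suc j) powr (\<alpha> - 2)))"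
      using M assms by (simp add: distrib_right)
    finally show ?thesis unfolding ba using M by (simp only: mult_ac abs_of_nonneg)
  qed
qed

section \<open>Stability of the scheme and the error as a discrete convolution\<close>

lemma damped_recursion_bound:
  fixes e r :: "nat \<Rightarrow> real"
  assumes "0 \<le> x" "e 0 = 0" "\<And>j. j < n \<Longrightarrow> \<bar>e (Suc j)\<bar> \<le> x * (\<bar>e j\<bar> + r j)"
  shows "\<bar>e n\<bar> \<le> (\<Sum>j<n. x ^ (n - j) * r j)"
  using assms(3)
proof (induction n)
  case 0
  then show ?case using assms by simp
next
  case (Suc n)
  have "\<bar>e (Suc n)\<bar> \<le> x * (\<bar>e n\<bar> + r n)"
    using Suc.prems by simp
  also have "\<dots> \<le> x * ((\<Sum>j<n. x ^ (n - j) * r j) + r n)"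
    using Suc assms(1) by (intro mult_left_mono) auto
  also have "\<dots> = (\<Sum>j<Suc n. x ^ (Suc n - j) * r j)"
    by (simp add: sum_distrib_left distrib_left Suc_diff_le mult_ac)
  finally show ?case .
qed

text \<open>With \<open>y = - \<kappa> * \<tau>\<close> this is where the step size restriction
  enters: the Euler factor \<open>1 / (1 - \<kappa> * \<tau>)\<close> decays at least at half the
  exact exponential rate.\<close>

lemma exp_half_le_one_plus:
  fixes y :: real
  assumes "0 \<le> y" "y \<le> 1"
  shows "exp (y / 2) \<le> 1 + y"
proof -
  have "exp (y / 2) \<le> 1 + y / 2 + (y / 2)\<^sup>2"
    using assms by (intro exp_bound) auto
  also have "(y / 2)\<^sup>2 \<le> y / 2"
    using assms by (simp add: power2_eq_square) (smt (verit) mult_left_le)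
  finally show ?thesis by simp
qed

lemma euler_error_convolution:
  assumes \<alpha>: "0 < \<alpha>" "\<alpha> < 1" and "\<kappa> < 0" "0 < T" "1 \<le> N"
    and ivp: "solves_ivp \<kappa> f u0 T u" and reg: "regularity_bound \<alpha> M T u"
    and \<tau>: "\<tau> = T / real N"
    and euler: "implicit_euler \<kappa> f u0 \<tau> N U"
    and "- \<kappa> * \<tau> < 1" "n \<le> N"
  shows "\<bar>u (real n * \<tau>) - U n\<bar> \<le> 4 * \<bar>M\<bar> * (1 + 1 / \<alpha>) * \<tau> powr \<alpha> *
    (\<Sum>j<n. exp (\<kappa> * \<tau> / 2) ^ (n - j) * real (Suc j) powr (\<alpha> - 2))"
proof -
  let ?B = "4 * \<bar>M\<bar> * (1 + 1 / \<alpha>) * \<tau> powr \<alpha>"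
  let ?x = "exp (\<kappa> * \<tau> / 2)"
  define e where "e n = u (real n * \<tau>) - U n" for n
  have \<tau>0: "0 < \<tau>" using assms by simp
  have pos: "0 < 1 - \<kappa> * \<tau>"
    using \<open>\<kappa> < 0\<close> \<tau>0 by (smt (verit) mult_neg_pos)
  have damp: "1 / (1 - \<kappa> * \<tau>) \<le> ?x"
  proof -
    have "exp ((- \<kappa> * \<tau>) / 2) \<le> 1 + (- \<kappa> * \<tau>)"
      using pos \<open>\<kappa> < 0\<close> \<open>- \<kappa> * \<tau> < 1\<close> \<tau>0 by (intro exp_half_le_one_plus) (auto simp: mult_nonpos_nonneg)
    then show ?thesis
      using pos by (simp add: exp_minus field_simps)
  qed
  have "\<bar>e n\<bar> \<le> (\<Sum>j<n. ?x ^ (n - j) * (?B * real (Suc j) powr (\<alpha> - 2)))"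
  proof (rule damped_recursion_bound)
    show "e 0 = 0"
      using ivp euler by (simp add: e_def solves_ivp_def implicit_euler_def)
    fix j assume "j < n"
    let ?t = "real (Suc j) * \<tau>"
    let ?R = "u ?t - u (real j * \<tau>) - \<tau> * deriv_within {0<..T} 1 u ?t"
    have jN: "Suc j \<le> N" using \<open>j < n\<close> \<open>n \<le> N\<close> by simp
    have tT: "?t \<le> T"
    proof -
      have "?t \<le> real N * \<tau>" using jN \<tau>0 by (intro mult_right_mono) auto
      then show ?thesis using \<tau> \<open>1 \<le> N\<close> by simp
    qed
    have R: "\<bar>?R\<bar> \<le> ?B * real (Suc j) powr (\<alpha> - 2)"
      using truncation_bound[OF \<alpha> \<tau>0 tT ivp reg] .
    \<comment> \<open>Inserting the differential equation into \<open>?R\<close> and subtracting the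
      scheme cancels \<open>f\<close>, which leaves a linear recursion for \<open>e\<close> forced
      by \<open>?R\<close>.\<close>
    have ode: "deriv_within {0<..T} 1 u ?t = \<kappa> * u ?t + f ?t"
      using ivp tT \<tau>0 unfolding solves_ivp_def by (auto simp del: deriv_within.simps)
    have "(U (Suc j) - U j) / \<tau> = \<kappa> * U (Suc j) + f ?t"
      using euler jN unfolding implicit_euler_def
      by (metis One_nat_def atLeastAtMost_iff diff_Suc_1 le_add1 plus_1_eq_Suc)
    then have "U (Suc j) - U j = \<tau> * (\<kappa> * U (Suc j) + f ?t)"
      using \<tau>0 by (simp add: field_simps)
    then have "(1 - \<kappa> * \<tau>) * e (Suc j) = e j + ?R"
      unfolding ode e_def by (simp add: algebra_simps)
    then have "e (Suc j) = 1 / (1 - \<kappa> * \<tau>) * (e j + ?R)"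
      using pos by (simp add: field_simps)
    then have "\<bar>e (Suc j)\<bar> = 1 / (1 - \<kappa> * \<tau>) * \<bar>e j + ?R\<bar>"
      using pos by (simp add: abs_mult)
    also have "\<dots> \<le> ?x * (\<bar>e j\<bar> + ?B * real (Suc j) powr (\<alpha> - 2))"
      using damp R pos by (intro mult_mono) auto
    finally show "\<bar>e (Suc j)\<bar> \<le> ?x * (\<bar>e j\<bar> + ?B * real (Suc j) powr (\<alpha> - 2))" .
  qed simp
  then show ?thesis
    by (simp add: e_def sum_distrib_left mult_ac)
qed

section \<open>Estimate of the convolution sum\<close>

lemma summable_Suc_powr: "a < - 1 \<Longrightarrow> summable (\<lambda>j. real (Suc j) powr a)"
  by (subst summable_Suc_iff[of "\<lambda>j. real j powr a"]) (simp add: summable_real_powr_iff)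

lemma convolution_sum_bound:
  fixes \<alpha> \<mu> :: real
  assumes "0 < \<alpha>" "\<alpha> < 1" "\<mu> \<le> 0" "2 \<le> n"
  shows "(\<Sum>j<n. exp (\<mu> / 2) ^ (n - j) * real (Suc j) powr (\<alpha> - 2))
    \<le> exp (\<mu> * real n / 4) * (\<Sum>j. real (Suc j) powr (\<alpha> - 2)) + 4 * real (n - 1) powr (\<alpha> - 1)"
proof -
  let ?q = "exp (\<mu> * real n / 4)"
  have summ: "summable (\<lambda>j. real (Suc j) powr (\<alpha> - 2))"
    using assms by (intro summable_Suc_powr) auto
  \<comment> \<open>Early terms have \<open>n - j \<ge> n / 2\<close>, late ones have
    \<open>Suc j \<ge> n / 2\<close>. Adding both bounds for every \<open>j\<close> avoids splitting
    the sum.\<close>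
  have "exp (\<mu> / 2) ^ (n - j) * real (Suc j) powr (\<alpha> - 2)
      \<le> ?q * real (Suc j) powr (\<alpha> - 2) + (real n / 2) powr (\<alpha> - 2)" if "j < n" for j
  proof (cases "2 * j \<le> n")
    case True
    have "exp (\<mu> / 2) ^ (n - j) = exp (\<mu> * ((real n - real j) / 2))"
      using that by (simp add: exp_of_nat_mult[symmetric] of_nat_diff algebra_simps)
    also have "\<dots> \<le> exp (\<mu> * (real n / 4))"
      using True \<open>\<mu> \<le> 0\<close> by (simp only: exp_le_cancel_iff) (intro mult_left_mono_neg, auto)
    finally have "exp (\<mu> / 2) ^ (n - j) * real (Suc j) powr (\<alpha> - 2) \<le> ?q * real (Suc j) powr (\<alpha> - 2)"
      by (intro mult_right_mono) auto
    then show ?thesis by (smt (verit) powr_ge_zero)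
  next
    case False
    have "exp (\<mu> / 2) ^ (n - j) \<le> 1"
      using \<open>\<mu> \<le> 0\<close> by (intro power_le_one) auto
    then have "exp (\<mu> / 2) ^ (n - j) * real (Suc j) powr (\<alpha> - 2) \<le> 1 * real (Suc j) powr (\<alpha> - 2)"
      by (intro mult_right_mono) auto
    also have "\<dots> \<le> (real n / 2) powr (\<alpha> - 2)"
      using False assms by (simp, intro powr_mono2') auto
    finally show ?thesis
      by (smt (verit) exp_gt_zero powr_ge_zero mult_nonneg_nonneg)
  qed
  then have "(\<Sum>j<n. exp (\<mu> / 2) ^ (n - j) * real (Suc j) powr (\<alpha> - 2))
      \<le> (\<Sum>j<n. ?q * real (Suc j) powr (\<alpha> - 2) + (real n / 2) powr (\<alpha> - 2))"
    by (intro sum_mono) auto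
  also have "\<dots> = ?q * (\<Sum>j<n. real (Suc j) powr (\<alpha> - 2)) + real n * (real n / 2) powr (\<alpha> - 2)"
    by (simp add: sum.distrib sum_distrib_left)
  also have "\<dots> \<le> ?q * (\<Sum>j. real (Suc j) powr (\<alpha> - 2)) + 4 * real (n - 1) powr (\<alpha> - 1)"
  proof (intro add_mono mult_left_mono)
    show "(\<Sum>j<n. real (Suc j) powr (\<alpha> - 2)) \<le> (\<Sum>j. real (Suc j) powr (\<alpha> - 2))"
      using summ by (intro sum_le_suminf) auto
    \<comment> \<open>The exponent \<open>\<alpha> - 1\<close> is negative, so passing from
      \<open>n\<close> to \<open>n - 1\<close> only enlarges the bound; \<open>n - 1\<close> is what
      \<open>t (n - 1)\<close> in the theorem calls for.\<close>
    have "real n * (real n / 2) powr (\<alpha> - 2) = 2 powr (2 - \<alpha>) * (real n * real n powr (\<alpha> - 2))"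
      using powr_minus_divide[of 2 "\<alpha> - 2"] by (simp add: powr_divide)
    also have "real n * real n powr (\<alpha> - 2) = real n powr (\<alpha> - 1)"
      using \<open>2 \<le> n\<close> powr_mult_base[of "real n" "\<alpha> - 2"] by simp
    also have "2 powr (2 - \<alpha>) * real n powr (\<alpha> - 1) \<le> 2 powr 2 * real (n - 1) powr (\<alpha> - 1)"
      using assms by (intro mult_mono powr_mono powr_mono2') auto
    finally show "real n * (real n / 2) powr (\<alpha> - 2) \<le> 4 * real (n - 1) powr (\<alpha> - 1)"
      by simp
  qed simp
  finally show ?thesis .
qed

section \<open>Lower bounds for the factors \<open>C1\<close> and \<open>C2\<close>\<close>

lemma one_le_C1:
  assumes "0 < \<alpha>" "\<alpha> < 1"
  shows "1 \<le> C1 \<alpha> \<kappa> t"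
proof -
  have "1 \<le> 2 / (1 - \<alpha>)" using assms by simp
  then show ?thesis unfolding C1_def by (smt (verit) exp_gt_zero)
qed

text \<open>The threshold in \<open>C2\<close> is exactly the zero of its bracket, and since
  \<open>\<kappa> < 0\<close>, later times make the exponential smaller and the bracket
  larger.\<close>

lemma C2_nonneg:
  assumes "\<alpha> < 1" "\<kappa> < 0"
  shows "0 \<le> C2 \<alpha> \<kappa> t"
proof (cases "t > 4 / \<kappa> * ln (1 - 2 powr (\<alpha> - 1))")
  case True
  have p: "2 powr (\<alpha> - 1) < 1" using powr_less_mono[of "\<alpha> - 1" 0 "2::real"] assms by simp
  have "\<kappa> * t / 4 < ln (1 - 2 powr (\<alpha> - 1))"
    using True \<open>\<kappa> < 0\<close> by (simp add: field_simps)
  then have "exp (\<kappa> * t / 4) < 1 - 2 powr (\<alpha> - 1)"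
    using p by (metis diff_gt_0_iff_gt exp_less_mono exp_ln)
  then have "2 powr (1 - \<alpha>) * 2 powr (\<alpha> - 1) \<le> 2 powr (1 - \<alpha>) * (1 - exp (\<kappa> * t / 4))"
    by (intro mult_left_mono) auto
  then have "1 \<le> 2 powr (1 - \<alpha>) * (1 - exp (\<kappa> * t / 4))"
    by (simp add: powr_add[symmetric])
  then show ?thesis using True assms by (simp add: C2_def)
qed (simp add: C2_def)

text \<open>The bound on the exponential is half of the value at which \<open>C2\<close> starts to be positive.\<close>

lemma C2_lower_bound:
  assumes "\<alpha> < 1" "\<kappa> < 0" "exp (\<kappa> * t / 4) < (1 - 2 powr (\<alpha> - 1)) / 2"
  shows "(2 powr (1 - \<alpha>) - 1) / (2 * (1 - \<alpha>)) \<le> C2 \<alpha> \<kappa> t"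
proof -
  have p: "2 powr (\<alpha> - 1) < 1" using powr_less_mono[of "\<alpha> - 1" 0 "2::real"] assms by simp
  have "(1 - 2 powr (\<alpha> - 1)) / 2 < 1 - 2 powr (\<alpha> - 1)" using p by simp
  with assms(3) have "exp (\<kappa> * t / 4) < 1 - 2 powr (\<alpha> - 1)" by (rule less_trans)
  then have "\<kappa> * t / 4 < ln (1 - 2 powr (\<alpha> - 1))"
    using p by (metis diff_gt_0_iff_gt exp_less_cancel_iff exp_ln)
  then have "t > 4 / \<kappa> * ln (1 - 2 powr (\<alpha> - 1))"
    using \<open>\<kappa> < 0\<close> by (simp add: field_simps)
  then have C2: "C2 \<alpha> \<kappa> t = (2 powr (1 - \<alpha>) * (1 - exp (\<kappa> * t / 4)) - 1) / (1 - \<alpha>)"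
    by (simp add: C2_def)
  \<comment> \<open>The left side is the bracket of \<open>C2\<close> with the exponential replaced
    by its upper bound.\<close>
  have "(2 powr (1 - \<alpha>) - 1) / 2 = 2 powr (1 - \<alpha>) * ((1 + 2 powr (\<alpha> - 1)) / 2) - (1::real)"
    by (simp add: distrib_left powr_add[symmetric] field_simps)
  also have "\<dots> \<le> 2 powr (1 - \<alpha>) * (1 - exp (\<kappa> * t / 4)) - 1"
    using assms by (intro diff_right_mono mult_left_mono) (auto simp: field_simps)
  finally have "(2 powr (1 - \<alpha>) - 1) / 2 \<le> 2 powr (1 - \<alpha>) * (1 - exp (\<kappa> * t / 4)) - 1" .
  then have "(2 powr (1 - \<alpha>) - 1) / 2 / (1 - \<alpha>)
      \<le> (2 powr (1 - \<alpha>) * (1 - exp (\<kappa> * t / 4)) - 1) / (1 - \<alpha>)"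
    using assms by (intro divide_right_mono) auto
  then show ?thesis by (simp add: C2)
qed

text \<open>\<open>C2\<close> vanishes up to its threshold and is arbitrarily small just beyond it,
  so the case split lies strictly later, at half the critical exponential \<open>q\<close>. Before
  that the \<open>C1\<close> term is at least \<open>q\<close>, hence at least \<open>q * p\<close>;
  after it \<open>C2\<close> is at least \<open>c\<close>. Both \<open>q\<close> and
  \<open>c\<close> depend on \<open>\<alpha>\<close> alone, which makes \<open>K\<close> uniform in
  \<open>\<kappa>\<close> and \<open>t\<close>.\<close>

lemma C1_C2_dominate:
  fixes \<alpha> :: real
  assumes "0 < \<alpha>" "\<alpha> < 1"
  shows "\<exists>K>0. \<forall>\<kappa> t p. \<kappa> < 0 \<longrightarrow> 0 \<le> p \<longrightarrow> p \<le> 1 \<longrightarrow>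
    p \<le> K * (C1 \<alpha> \<kappa> t * exp (\<kappa> * t / 4) + C2 \<alpha> \<kappa> t * p)"
proof -
  define q where "q = (1 - 2 powr (\<alpha> - 1)) / 2"
  define c where "c = (2 powr (1 - \<alpha>) - 1) / (2 * (1 - \<alpha>))"
  have q: "0 < q" using powr_less_mono[of "\<alpha> - 1" 0 "2::real"] assms by (simp add: q_def)
  have "1 < 2 powr (1 - \<alpha>)" using assms by simp
  then have c: "0 < c" using assms by (simp add: c_def)
  have "p \<le> (1 / q + 1 / c) * (C1 \<alpha> \<kappa> t * exp (\<kappa> * t / 4) + C2 \<alpha> \<kappa> t * p)"
    if "\<kappa> < 0" "0 \<le> p" "p \<le> 1" for \<kappa> t p
  proof -
    let ?X = "C1 \<alpha> \<kappa> t * exp (\<kappa> * t / 4)" and ?Y = "C2 \<alpha> \<kappa> t * p"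
    have X: "exp (\<kappa> * t / 4) \<le> ?X" using one_le_C1[OF assms, of \<kappa> t] by simp
    have X0: "0 \<le> ?X" using X by (smt (verit) exp_gt_zero)
    have Y0: "0 \<le> ?Y" using C2_nonneg assms that by simp
    have "p \<le> 1 / q * (?X + ?Y) \<or> p \<le> 1 / c * (?X + ?Y)"
    proof (cases "exp (\<kappa> * t / 4) < q")
      case True
      then have "c * p \<le> ?Y"
        using C2_lower_bound[of \<alpha> \<kappa> t] assms that unfolding q_def c_def
        by (intro mult_right_mono) auto
      then have "c * p \<le> ?X + ?Y" using X0 by linarith
      then show ?thesis using c by (simp add: field_simps)
    next
      case False
      have "q * p \<le> q" using q that by (simp add: mult_left_le)
      then have "q * p \<le> ?X + ?Y" using False X Y0 by linarith
      then show ?thesis using q by (simp add: field_simps)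
    qed
    moreover have "0 \<le> 1 / q * (?X + ?Y)" "0 \<le> 1 / c * (?X + ?Y)"
      using q c X0 Y0 by auto
    ultimately show ?thesis by (smt (verit) distrib_right)
  qed
  then show ?thesis using q c by (intro exI[of _ "1 / q + 1 / c"]) (auto intro: add_pos_pos)
qed

theorem theorem2p1:
  fixes \<alpha> M :: real
  assumes "0 < \<alpha>" and "\<alpha> < 1"
  shows "\<exists>C>0. \<forall>(\<kappa>::real) (T::real) (N::nat) (u0::real)
           (f :: real \<Rightarrow> real) (u :: real \<Rightarrow> real) (U :: nat \<Rightarrow> real).
         (let \<tau> = T / real N;
              t = (\<lambda>n. real n * \<tau>);
              e = (\<lambda>n. u (t n) - U n)
          in \<kappa> < 0 \<longrightarrow> 0 < T \<longrightarrow> 2 \<le> N \<longrightarrow>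
             solves_ivp \<kappa> f u0 T u \<longrightarrow>
             regularity_bound \<alpha> M T u \<longrightarrow>
             implicit_euler \<kappa> f u0 \<tau> N U \<longrightarrow>
             - \<kappa> * \<tau> < 1 \<longrightarrow>
             (\<forall>n\<in>{2..N}.
                \<bar>e n\<bar> \<le> exp (\<kappa> * t n / 2) * \<bar>e 0\<bar>
                  + C * (C1 \<alpha> \<kappa> (t n) * exp (\<kappa> * t n / 4) * \<tau> powr \<alpha>
                         + C2 \<alpha> \<kappa> (t n) * t (n - 1) powr (\<alpha> - 1) * \<tau>)))"
proof -
  from C1_C2_dominate[OF assms] obtain K where K: "0 < K"
    and dom: "\<And>\<kappa> t p. \<kappa> < 0 \<Longrightarrow> 0 \<le> p \<Longrightarrow> p \<le> 1 \<Longrightarrow>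
      p \<le> K * (C1 \<alpha> \<kappa> t * exp (\<kappa> * t / 4) + C2 \<alpha> \<kappa> t * p)"
    by blast
  define S where "S = (\<Sum>j. real (Suc j) powr (\<alpha> - 2))"
  define B where "B = 4 * \<bar>M\<bar> * (1 + 1 / \<alpha>)"
  have B: "0 \<le> B" using assms by (simp add: B_def)
  have S: "0 \<le> S" unfolding S_def by (rule suminf_nonneg[OF summable_Suc_powr]) (use assms in auto)
  \<comment> \<open>\<open>1 + B\<close> replaces \<open>B\<close> to keep the constant positive
    when \<open>M = 0\<close>.\<close>
  let ?C = "(1 + B) * (S + 4 * K)"
  have main: "\<bar>u (real n * \<tau>) - U n\<bar> \<le> ?C *
      (C1 \<alpha> \<kappa> (real n * \<tau>) * exp (\<kappa> * (real n * \<tau>) / 4) * \<tau> powr \<alpha>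
       + C2 \<alpha> \<kappa> (real n * \<tau>) * (real (n - 1) * \<tau>) powr (\<alpha> - 1) * \<tau>)"
    if \<kappa>: "\<kappa> < 0" and T: "0 < T" and N: "2 \<le> N"
      and ivp: "solves_ivp \<kappa> f u0 T u" and reg: "regularity_bound \<alpha> M T u"
      and \<tau>: "\<tau> = T / real N" and euler: "implicit_euler \<kappa> f u0 \<tau> N U"
      and small: "- \<kappa> * \<tau> < 1" and n: "2 \<le> n" "n \<le> N"
    for \<kappa> T N u0 f u U \<tau> n
  proof -
    have \<tau>0: "0 < \<tau>" using T N \<tau> by simp
    let ?t = "real n * \<tau>"
    let ?q = "exp (\<kappa> * ?t / 4)"
    \<comment> \<open>\<open>p\<close> is the scale-free form of the late contribution:
      \<open>p * \<tau> powr \<alpha>\<close> equals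
      \<open>(real (n - 1) * \<tau>) powr (\<alpha> - 1) * \<tau>\<close>. As
      \<open>n \<ge> 2\<close>, it is at most 1.\<close>
    define p where "p = real (n - 1) powr (\<alpha> - 1)"
    let ?W = "C1 \<alpha> \<kappa> ?t * ?q + C2 \<alpha> \<kappa> ?t * p"
    have p: "0 \<le> p" "p \<le> 1"
      using powr_mono2'[of "\<alpha> - 1" 1 "real (n - 1)"] n assms
      by (auto simp: p_def)
    have qW: "?q \<le> ?W"
    proof -
      have "?q \<le> C1 \<alpha> \<kappa> ?t * ?q" using one_le_C1[OF assms, of \<kappa> ?t] by simp
      moreover have "0 \<le> C2 \<alpha> \<kappa> ?t * p" using C2_nonneg assms \<kappa> p by simp
      ultimately show ?thesis by linarith
    qed
    have "\<bar>u ?t - U n\<bar> \<le> B * \<tau> powr \<alpha> *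
        (\<Sum>j<n. exp (\<kappa> * \<tau> / 2) ^ (n - j) * real (Suc j) powr (\<alpha> - 2))"
      unfolding B_def using euler_error_convolution[OF assms \<kappa> T _ ivp reg \<tau> euler small n(2)] N
      by simp
    also have "\<dots> \<le> B * \<tau> powr \<alpha> * (?q * S + 4 * p)"
      using convolution_sum_bound[of \<alpha> "\<kappa> * \<tau>" n] assms \<kappa> \<tau>0 n B unfolding S_def p_def
      by (intro mult_left_mono) (auto simp: mult_ac mult_nonpos_nonneg)
    also have "\<dots> \<le> B * \<tau> powr \<alpha> * ((S + 4 * K) * ?W)"
    proof (intro mult_left_mono)
      have "?q * S \<le> ?W * S" using qW S by (intro mult_right_mono)
      moreover have "p \<le> K * ?W" using dom[OF \<kappa> p] .
      ultimately show "?q * S + 4 * p \<le> (S + 4 * K) * ?W"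
        by (simp add: distrib_right mult.commute)
    qed (use B in auto)
    also have "\<dots> \<le> (1 + B) * \<tau> powr \<alpha> * ((S + 4 * K) * ?W)"
      using S K qW by (intro mult_right_mono mult_nonneg_nonneg) (auto intro: order_trans[of _ ?q])
    also have "\<dots> = ?C * (?W * \<tau> powr \<alpha>)" by (simp add: mult_ac)
    also have "?W * \<tau> powr \<alpha> = C1 \<alpha> \<kappa> ?t * ?q * \<tau> powr \<alpha>
        + C2 \<alpha> \<kappa> ?t * (real (n - 1) * \<tau>) powr (\<alpha> - 1) * \<tau>"
      using \<tau>0 n by (simp add: p_def powr_mult powr_diff distrib_right)
    finally show ?thesis .
  qed
  have "0 < ?C" using B S K by (simp add: add_nonneg_pos add_pos_nonneg)
  \<comment> \<open>The initial error is zero by \<open>u 0 = U 0\<close>, so \<open>main\<close>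
    has no such term; the nonnegative initial term is added on the right here.\<close>
  then show ?thesis
    unfolding Let_def
    by (intro exI[of _ ?C] conjI allI impI ballI, assumption)
      (rule order_trans[OF main], assumption+, auto simp: le_add_same_cancel2)
qed

end
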